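(* There are tournament forests $H$ satisfying $t(T_n,H)=\omega(n\log n)$, i.e., $t(T_n,H)/(n\log n)\to\infty$ as $n\to\infty$.
   Context: A tournament is a digraph having exactly one of the edges $(u,v),(v,u)$ for every pair of distinct vertices $u,v$. A set of vertices of a tournament is transitive if the sub-tournament it induces has no directed cycle. $T_n$ is the transitive tournament on $n$ vertices. A tournament $H$ is a tournament forest if its vertex set can be partitioned into two transitive sets $L,R$ such that the undirected bipartite graph on $L$ and $R$ in which $\ell\in L$ is adjacent to $r\in R$ if and only if $H$ has the edge $(r,\ell)$ (pointing from $r$ to $\ell$) is a forest. Adding an edge to a tournament means adding the reverse $(v,u)$ of some existing edge $(u,v)$. A digraph contains a copy of $H$ if it has a (not necessarily induced) subgraph isomorphic to $H$. For $n\ge |V(H)|$, $t(T_n,H)$ is the smallest integer $t$ such that adding any $t$ edges to $T_n$ results in a digraph containing a copy of $H$. *)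

theory Defs
  imports Complex_Main "Graph_Theory.Graph_Theory"
begin

text \<open>Digraphs are finite and loop-free, without parallel arcs.\<close>

definition tournament :: "'a pair_pre_digraph \<Rightarrow> bool" where
  "tournament G \<longleftrightarrow> pair_digraph G \<and>
     (\<forall>u \<in> pverts G. \<forall>v \<in> pverts G. u \<noteq> v \<longrightarrow> ((u, v) \<in> parcs G \<longleftrightarrow> (v, u) \<notin> parcs G))"

definition transitive_set :: "'a pair_pre_digraph \<Rightarrow> 'a set \<Rightarrow> bool" where
  "transitive_set G S \<longleftrightarrow> S \<subseteq> pverts G \<and>
     \<not> (\<exists>p. pre_digraph.cycle (with_proj G \<restriction> S) p)"

text \<open>
  An undirected graph is represented by the symmetric digraph having both orientations of every
  edge.  Traversing one edge back and forth is then a directed cycle of length 2, which is not a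
  cycle of the undirected graph; cycles of length at least 3 are exactly the undirected cycles.
  (The library's \<^const>\<open>forest\<close> has no such length restriction, so it would hold
  of a symmetric digraph only if there are no edges at all.)
\<close>

definition undirected_forest :: "'a pair_pre_digraph \<Rightarrow> bool" where
  "undirected_forest G \<longleftrightarrow> \<not> (\<exists>p. pre_digraph.cycle (with_proj G) p \<and> 3 \<le> length p)"

definition back_graph :: "'a pair_pre_digraph \<Rightarrow> 'a set \<Rightarrow> 'a set \<Rightarrow> 'a pair_pre_digraph" where
  "back_graph H L R = mk_symmetric (with_proj
     \<lparr> pverts = L \<union> R, parcs = {(r, l). r \<in> R \<and> l \<in> L \<and> (r, l) \<in> parcs H} \<rparr>)"

definition tournament_forest :: "'a pair_pre_digraph \<Rightarrow> bool" where
  "tournament_forest H \<longleftrightarrow> tournament H \<and>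
     (\<exists>L R. L \<union> R = pverts H \<and> L \<inter> R = {} \<and> transitive_set H L \<and> transitive_set H R \<and>
        undirected_forest (back_graph H L R))"

definition trans_tournament :: "nat \<Rightarrow> nat pair_pre_digraph" where
  "trans_tournament n = \<lparr> pverts = {..<n}, parcs = {(u, v). u < v \<and> v < n} \<rparr>"

definition add_edges :: "'a pair_pre_digraph \<Rightarrow> 'a rel \<Rightarrow> 'a pair_pre_digraph" where
  "add_edges T B = \<lparr> pverts = pverts T, parcs = parcs T \<union> B \<rparr>"

definition contains_copy :: "'a pair_pre_digraph \<Rightarrow> 'b pair_pre_digraph \<Rightarrow> bool" where
  "contains_copy D H \<longleftrightarrow> (\<exists>S. subgraph S (with_proj D) \<and> digraph_iso (with_proj H) S)"

text \<open>
  The number \<open>t(T\<^sub>n, H)\<close>; meaningful for \<open>n \<ge> card (pverts H)\<close> only.  There, adding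
  all \<open>n choose 2\<close> reversed edges produces a copy of \<open>H\<close>, so the minimum is not attained
  merely because no set \<open>B\<close> of \<open>t\<close> reversed edges exists.
\<close>

definition t_trans :: "nat \<Rightarrow> 'a pair_pre_digraph \<Rightarrow> nat" where
  "t_trans n H = (LEAST t. \<forall>B. B \<subseteq> (parcs (trans_tournament n))\<inverse> \<and> card B = t \<longrightarrow>
     contains_copy (add_edges (trans_tournament n) B) H)"

end

theory Submission
  imports Defs "HOL-Library.Product_Lexorder" "HOL-Library.FuncSet" "HOL-Real_Asymp.Real_Asymp"
begin

text \<open>
  A copy of \<open>H\<close> in a transitive tournament with a set \<open>B\<close> of added backward edges is an injection \<open>f\<close>
  of the vertices of \<open>H\<close> into the integers such that each arc of \<open>H\<close> goes up under \<open>f\<close> or is mapped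
  into \<open>B\<close>.  A lower bound on \<open>t_trans n H\<close> is thus a large \<open>B\<close> without such an \<open>f\<close>.  All edges of the
  \<open>B\<close> used here lead from the upper half of the vertices, called columns, to the lower half, called
  rows, so \<open>B\<close> is a bipartite graph with a linear order on both classes.

  The graph.  Rows and columns are words with about \<open>m\<close> digits and base polynomial in \<open>m\<close>, ordered
  as numbers.  A row \<open>x\<close> has one column for each pair \<open>j < i\<close> of positions (if no digit overflows): \<open>x\<close>
  with a number of at least \<open>m\<close> added to digit \<open>i\<close> and the number \<open>i\<close> added to digit \<open>j\<close>.  So the degrees
  are of order \<open>m\<^sup>2\<close>, the number of vertices is \<open>m\<close> to a power linear in \<open>m\<close>, and there are of order
  \<open>n (ln n / ln ln n)\<^sup>2\<close> edges.  A column of \<open>x\<close> lower than \<open>y = bump m x i j\<close> differs from \<open>y\<close> first at \<open>i\<close>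
  or at \<open>j\<close>, and by an amount that depends only on \<open>x, i, j\<close>: there are just two ways to drop from \<open>y\<close>.
  The increment at \<open>i\<close> contains a checksum of the lower digits, which makes the ways to drop from \<open>y\<close>
  disjoint for distinct rows \<open>x\<close> and \<open>x'\<close> (\<open>common_column_profiles_disjoint\<close>).  Hence the graph has no
  4-cycles, and columns of \<open>x\<close> and \<open>x'\<close> below \<open>y\<close> cannot alternate much: for rows \<open>x < x'\<close> there are no
  columns \<open>b0 < a1 < b1 < a2 < y\<close> with \<open>a1, a2, y\<close> adjacent to \<open>x\<close> and \<open>b0, b1, y\<close> adjacent to \<open>x'\<close>
  (\<open>word_edges_alternation_free\<close>).

  The tournament.  This pattern, with its two rows and five columns, is a tree.  But \<open>f\<close>
  may map any vertices of the tournament to rows, not just those that are rows of the pattern.  This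
  is why the tournament contains several copies: with five of them, each way to distribute the
  vertices either respects a copy, or leaves a directed triangle on one side, or creates a 4-cycle
  (\<open>witness_not_embeddable\<close>).
\<close>

section \<open>An ordered bipartite graph on words\<close>

definition base :: "nat \<Rightarrow> nat" where
  "base m = 4 * m\<^sup>2"

definition radix :: "nat \<Rightarrow> (nat \<Rightarrow> nat) \<Rightarrow> nat" where
  "radix m x = (\<Sum>k\<le>m. x k * base m ^ k)"

text \<open>
  The digit at the most significant position \<open>m\<close> is never changed along an edge; its range \<open>K\<close>
  only multiplies the size of the construction, so that every vertex number \<open>n\<close>, not just the
  numbers \<open>2 * base m ^ m\<close>, can be filled up to a constant factor.
\<close>

definition digits :: "nat \<Rightarrow> nat \<Rightarrow> nat \<Rightarrow> nat" where
  "digits m K k = (if k = m then K else base m)"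

definition words :: "nat \<Rightarrow> nat \<Rightarrow> (nat \<Rightarrow> nat) set" where
  "words m K = (\<Pi>\<^sub>E k\<in>{..m}. {..<digits m K k})"

lemma word_digit: "x \<in> words m K \<Longrightarrow> k \<le> m \<Longrightarrow> x k < digits m K k"
  by (auto simp: words_def dest: PiE_mem)

lemma word_low_digit: "x \<in> words m K \<Longrightarrow> k < m \<Longrightarrow> x k < base m"
  using word_digit[of x m K k] by (simp add: digits_def)

lemma low_digits_less:
  fixes q :: nat
  assumes "\<And>k. k < i \<Longrightarrow> x k < q"
  shows "(\<Sum>k<i. x k * q ^ k) < q ^ i"
  using assms
proof (induction i)
  case (Suc i)
  have "(\<Sum>k<Suc i. x k * q ^ k) < q ^ i + x i * q ^ i"
    using Suc by simp
  also have "\<dots> = Suc (x i) * q ^ i"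
    by simp
  also have "\<dots> \<le> q * q ^ i"
    using Suc.prems[of i] by (intro mult_right_mono) auto
  finally show ?case
    by simp
qed simp

lemma radix_less:
  assumes x: "x \<in> words m K" and i: "i \<le> m"
    and above: "\<And>k. i < k \<Longrightarrow> x k = y k" and at: "x i < y i"
  shows "radix m x < radix m y"
proof -
  have split: "radix m z = (\<Sum>k<i. z k * base m ^ k) + z i * base m ^ i
      + (\<Sum>k\<in>{i<..m}. z k * base m ^ k)" for z
  proof -
    have "{..m} = {..<i} \<union> {i} \<union> {i<..m}"
      using i by auto
    moreover have "{..<i} \<inter> {i<..m} = {}"
      by auto
    ultimately show ?thesis
      unfolding radix_def by (simp add: sum.union_disjoint)
  qed
  have "(\<Sum>k<i. x k * base m ^ k) < base m ^ i"
    using word_low_digit[OF x] i by (intro low_digits_less) auto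
  then have "(\<Sum>k<i. x k * base m ^ k) + x i * base m ^ i < Suc (x i) * base m ^ i"
    by simp
  also have "\<dots> \<le> y i * base m ^ i"
    using at by (intro mult_right_mono) auto
  finally show ?thesis
    unfolding split[of x] split[of y] using above by simp
qed

lemma radix_bound:
  assumes "x \<in> words m K"
  shows "radix m x < K * base m ^ m"
proof -
  have top: "x m < K"
    using word_digit[OF assms, of m] by (simp add: digits_def)
  have "(\<Sum>k<m. x k * base m ^ k) < base m ^ m"
    using word_low_digit[OF assms] by (intro low_digits_less) auto
  then have "radix m x < Suc (x m) * base m ^ m"
    by (simp add: radix_def lessThan_Suc_atMost[symmetric])
  also have "\<dots> \<le> K * base m ^ m"
    using top by (intro mult_right_mono) auto
  finally show ?thesis .
qed

lemma inj_on_radix: "inj_on (radix m) (words m K)"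
proof (rule inj_onI, rule ccontr)
  fix x y assume xy: "x \<in> words m K" "y \<in> words m K" "radix m x = radix m y" "x \<noteq> y"
  define S where "S = {k. x k \<noteq> y k}"
  have sub: "S \<subseteq> {..m}"
    using xy by (auto simp: S_def words_def PiE_iff extensional_def)
  then have fin: "finite S"
    using finite_subset by blast
  have "S \<noteq> {}"
    using xy by (auto simp: S_def)
  then have top: "Max S \<in> S" "\<And>k. Max S < k \<Longrightarrow> x k = y k"
    using fin Max_in Max_ge by (auto simp: S_def)
  have "Max S \<le> m"
    using top(1) sub by blast
  moreover have "x (Max S) < y (Max S) \<or> y (Max S) < x (Max S)"
    using top(1) by (auto simp: S_def)
  ultimately show False
    using radix_less[OF xy(1), of "Max S" y] radix_less[OF xy(2), of "Max S" x] top(2) xy(3) by auto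
qed

text \<open>
  A word \<open>a\<close> below \<open>y\<close> is described by the place where it first falls short of \<open>y\<close>, reading from
  the most significant digit, and by the amount it falls short there.  Pairs are compared
  lexicographically: an earlier or a deeper drop makes the word smaller.
\<close>

definition drops :: "(nat \<Rightarrow> nat) \<Rightarrow> (nat \<Rightarrow> nat) \<Rightarrow> nat \<times> nat \<Rightarrow> bool" where
  "drops y a P \<longleftrightarrow> (\<forall>k>fst P. a k = y k) \<and> a (fst P) + snd P = y (fst P) \<and> 0 < snd P"

lemma larger_drop_less:
  assumes "a \<in> words m K" "drops y a P" "drops y b P'" "P' < P" "fst P \<le> m"
  shows "radix m a < radix m b"
  using assms by (intro radix_less[of a m K "fst P"]) (auto simp: drops_def less_prod_def')

text \<open>
  The checksum makes the increment at position \<open>i\<close> depend on all the digits below \<open>i\<close>.  Its only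
  purpose is that two distinct rows which reach a common column by bumping the same position \<open>i\<close>, and hence
  differ in the digits below \<open>i\<close>, must differ in the digit at \<open>i\<close> itself.
\<close>

definition checksum :: "nat \<Rightarrow> nat \<Rightarrow> (nat \<Rightarrow> nat) \<Rightarrow> nat" where
  "checksum m i x = (\<Sum>k<i. k * x k) mod m\<^sup>2"

text \<open>
  The two increments at the positions \<open>i\<close> and \<open>j < i\<close> are chosen such that they can never be
  confused: the upper one is at least \<open>m\<close>, the lower one is less than \<open>m\<close> and tells \<open>i\<close>.
\<close>

definition bump :: "nat \<Rightarrow> (nat \<Rightarrow> nat) \<Rightarrow> nat \<Rightarrow> nat \<Rightarrow> (nat \<Rightarrow> nat)" where
  "bump m x i j = x(i := x i + m + checksum m i x, j := x j + i)"

definition word_edges :: "nat \<Rightarrow> nat \<Rightarrow> ((nat \<Rightarrow> nat) \<times> (nat \<Rightarrow> nat)) set" where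
  "word_edges m K = {(x, bump m x i j) | x i j.
     j < i \<and> i < m \<and> x \<in> words m K \<and> bump m x i j \<in> words m K}"

lemma checksum_cong: "(\<And>k. k < i \<Longrightarrow> x k = y k) \<Longrightarrow> checksum m i x = checksum m i y"
  by (simp add: checksum_def)

lemma checksum_shift:
  assumes "j < i"
  shows "checksum m i (x(j := x j + c)) = ((\<Sum>k<i. k * x k) + j * c) mod m\<^sup>2"
proof -
  have "(\<Sum>k<i. k * (x(j := x j + c)) k) = j * (x j + c) + (\<Sum>k\<in>{..<i} - {j}. k * x k)"
    using assms by (subst sum.remove[of _ j]) auto
  also have "\<dots> = (\<Sum>k<i. k * x k) + j * c"
    using assms by (subst (2) sum.remove[of _ j]) (auto simp: algebra_simps)
  finally show ?thesis
    by (simp add: checksum_def)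
qed

text \<open>
  Below position \<open>i\<close>, the rows become equal when \<open>i\<close> is added to digit \<open>j\<close> of one and to digit \<open>j'\<close>
  of the other.  Since each digit is weighted by its position, this changes the digit sums by \<open>j * i\<close>
  and \<open>j' * i\<close>, which are different and less than the modulus \<open>m\<^sup>2\<close>.
\<close>

lemma sibling_rows_separated:
  assumes eq: "bump m x i j = bump m x' i j'" and ij: "j < i" "j' < i" "i < m" "j \<noteq> j'"
  shows "checksum m i x \<noteq> checksum m i x'"
proof
  assume same: "checksum m i x = checksum m i x'"
  have tail: "(x(j := x j + i)) k = (x'(j' := x' j' + i)) k" if "k < i" for k
    using fun_cong[OF eq, of k] that by (auto simp: bump_def split: if_splits)
  let ?s = "\<Sum>k<i. k * x k" and ?s' = "\<Sum>k<i. k * x' k"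
  have "checksum m i (x(j := x j + i)) = checksum m i (x'(j' := x' j' + i))"
    by (rule checksum_cong) (rule tail)
  then have "(?s + j * i) mod m\<^sup>2 = (?s' + j' * i) mod m\<^sup>2"
    using ij by (simp only: checksum_shift)
  then have "(int ?s + int (j * i)) mod int (m\<^sup>2) = (int ?s' + int (j' * i)) mod int (m\<^sup>2)"
    by (metis of_nat_add zmod_int)
  moreover have "int ?s mod int (m\<^sup>2) = int ?s' mod int (m\<^sup>2)"
    using same unfolding checksum_def by (metis zmod_int)
  ultimately have "((int ?s + int (j * i)) - int ?s) mod int (m\<^sup>2)
      = ((int ?s' + int (j' * i)) - int ?s') mod int (m\<^sup>2)"
    by (rule mod_diff_cong)
  then have "int (j * i) mod int (m\<^sup>2) = int (j' * i) mod int (m\<^sup>2)"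
    by simp
  then have "(j * i) mod m\<^sup>2 = (j' * i) mod m\<^sup>2"
    by (metis of_nat_eq_iff zmod_int)
  moreover have "j * i < m\<^sup>2" "j' * i < m\<^sup>2"
    unfolding power2_eq_square using ij by (auto intro!: mult_strict_mono)
  ultimately show False
    using ij by auto
qed

lemma row_drops:
  assumes "j < i" "i < m"
  shows "drops (bump m x i j) x (i, m + checksum m i x)"
  using assms by (auto simp: drops_def bump_def)

text \<open>
  The two possible drops of a column of \<open>x\<close> from the higher column \<open>bump m x i j\<close>: the lower column
  either leaves the digit \<open>i\<close> of \<open>x\<close> as it is, or agrees in digit \<open>i\<close> and leaves digit \<open>j\<close> as it is.
\<close>

definition profiles :: "nat \<Rightarrow> (nat \<Rightarrow> nat) \<Rightarrow> nat \<Rightarrow> nat \<Rightarrow> (nat \<times> nat) set" where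
  "profiles m x i j = {(i, m + checksum m i x), (j, i)}"

lemma lower_neighbour_drops:
  assumes x: "x \<in> words m K" and ij: "j < i" "i < m" and ij1: "j1 < i1" "i1 < m"
    and y: "bump m x i j \<in> words m K"
    and less: "radix m (bump m x i1 j1) < radix m (bump m x i j)"
  shows "\<exists>P \<in> profiles m x i j. drops (bump m x i j) (bump m x i1 j1) P"
proof -
  consider "i1 < i" | "i1 = i" "j1 < j" | "i1 = i" "j1 = j" | "i1 = i" "j < j1" | "i < i1"
    by linarith
  then show ?thesis
  proof cases
    case 1
    then show ?thesis
      using ij ij1 by (intro bexI[of _ "(i, m + checksum m i x)"]) (auto simp: drops_def bump_def profiles_def)
  next
    case 2
    then show ?thesis
      using ij ij1 by (intro bexI[of _ "(j, i)"]) (auto simp: drops_def bump_def profiles_def)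
  next
    case 3
    then show ?thesis
      using less by simp
  next
    case 4
    have "radix m (bump m x i j) < radix m (bump m x i1 j1)"
      using 4 ij ij1 by (intro radix_less[OF y, of j1]) (auto simp: bump_def)
    then show ?thesis
      using less by simp
  next
    case 5
    have "radix m (bump m x i j) < radix m (bump m x i1 j1)"
      using 5 ij ij1 by (intro radix_less[OF y, of i1]) (auto simp: bump_def)
    then show ?thesis
      using less by simp
  qed
qed

text \<open>
  This is the lemma on which everything rests.  A drop \<open>(j, i)\<close> determines the edge, hence the row;
  the amount of a drop \<open>(i, m + checksum m i x)\<close> is at least \<open>m\<close>, so it is no drop of the first
  kind; and two rows with the same \<open>i\<close> have different checksums.
\<close>

lemma common_column_profiles_disjoint:
  assumes eq: "bump m x i j = bump m x' i' j'" and ne: "x \<noteq> x'"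
    and ij: "j < i" "i < m" "j' < i'" "i' < m"
  shows "profiles m x i j \<inter> profiles m x' i' j' = {}"
proof -
  have same: "x = x'" if "i = i'" "j = j'"
  proof
    fix k
    have low: "x k = x' k" if "k < i" for k
      using fun_cong[OF eq, of k] that \<open>i = i'\<close> \<open>j = j'\<close> by (auto simp: bump_def split: if_splits)
    then have "checksum m i x = checksum m i x'"
      by (rule checksum_cong)
    then have at: "x i = x' i"
      using fun_cong[OF eq, of i] ij that by (simp add: bump_def)
    show "x k = x' k"
    proof (cases "k < i")
      case True
      then show ?thesis by (rule low)
    next
      case False
      then show ?thesis
        using fun_cong[OF eq, of k] at ij that by (cases "k = i") (simp_all add: bump_def)
    qed
  qed
  have "checksum m i x \<noteq> checksum m i' x'" if "i = i'"
    using sibling_rows_separated[of m x i j x' j'] same eq ne ij that by blast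
  then show ?thesis
    using same ne ij by (auto simp: profiles_def)
qed

lemma word_edge_profiles:
  assumes "(x, y) \<in> word_edges m K"
  obtains i j where "j < i" "i < m" "y = bump m x i j" "x \<in> words m K" "y \<in> words m K"
    and "\<And>a. (x, a) \<in> word_edges m K \<Longrightarrow> radix m a < radix m y \<Longrightarrow>
      a \<in> words m K \<and> (\<exists>P \<in> profiles m x i j. drops y a P)"
proof -
  obtain i j where ij: "j < i" "i < m" "y = bump m x i j" "x \<in> words m K" "y \<in> words m K"
    using assms by (auto simp: word_edges_def)
  have "a \<in> words m K \<and> (\<exists>P \<in> profiles m x i j. drops y a P)"
    if a: "(x, a) \<in> word_edges m K" "radix m a < radix m y" for a
  proof -
    obtain i1 j1 where "j1 < i1" "i1 < m" "a = bump m x i1 j1" "a \<in> words m K"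
      using a(1) by (auto simp: word_edges_def)
    then show ?thesis
      using lower_neighbour_drops[of x m K j i j1 i1] ij a(2) by auto
  qed
  then show thesis
    using that ij by blast
qed

text \<open>
  In a cycle of length 4, the lower of its two columns would drop from the higher one by a profile
  of either row, but the rows have no profile in common.
\<close>

lemma word_edges_four_cycle_free:
  assumes "(x, y) \<in> word_edges m K" "(x', y) \<in> word_edges m K"
    and "(x, z) \<in> word_edges m K" "(x', z) \<in> word_edges m K" and "x \<noteq> x'"
  shows "y = z"
proof -
  have False if xy: "(x, y) \<in> word_edges m K" "(x', y) \<in> word_edges m K"
    and xz: "(x, z) \<in> word_edges m K" "(x', z) \<in> word_edges m K"
    and less: "radix m z < radix m y" for y z
  proof -
    obtain i j where ij: "j < i" "i < m" "y = bump m x i j"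
      and P: "\<And>a. (x, a) \<in> word_edges m K \<Longrightarrow> radix m a < radix m y \<Longrightarrow>
        a \<in> words m K \<and> (\<exists>P \<in> profiles m x i j. drops y a P)"
      using word_edge_profiles[OF xy(1)] by metis
    obtain i' j' where ij': "j' < i'" "i' < m" "y = bump m x' i' j'"
      and P': "\<And>a. (x', a) \<in> word_edges m K \<Longrightarrow> radix m a < radix m y \<Longrightarrow>
        a \<in> words m K \<and> (\<exists>P \<in> profiles m x' i' j'. drops y a P)"
      using word_edge_profiles[OF xy(2)] by metis
    obtain Q Q' where Q: "Q \<in> profiles m x i j" "Q' \<in> profiles m x' i' j'" "drops y z Q" "drops y z Q'"
      using P[OF xz(1) less] P'[OF xz(2) less] by blast
    have z: "z \<in> words m K"
      using P[OF xz(1) less] by blast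
    have "profiles m x i j \<inter> profiles m x' i' j' = {}"
      using common_column_profiles_disjoint[of m x i j x' i' j'] ij ij' \<open>x \<noteq> x'\<close> by simp
    then have "Q \<noteq> Q'"
      using Q by blast
    moreover have "fst Q \<le> m" "fst Q' \<le> m"
      using Q(1,2) ij ij' by (auto simp: profiles_def)
    ultimately show False
      using larger_drop_less[OF z Q(3) Q(4)] larger_drop_less[OF z Q(4) Q(3)]
      by (metis less_irrefl linorder_neqE)
  qed
  moreover have "y \<in> words m K" "z \<in> words m K"
    using assms by (auto simp: word_edges_def)
  ultimately show ?thesis
    using assms inj_on_radix[of m K] by (metis inj_onD linorder_neqE_nat)
qed

text \<open>
  Along \<open>b0 < a1 < b1 < a2\<close> the drops from \<open>y\<close> decrease, and they decrease strictly because they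
  belong alternately to the disjoint profile sets of \<open>x'\<close> and \<open>x\<close>.  Each set has two elements, so
  \<open>b0\<close> and \<open>a1\<close> have the larger drop of their row.  But this is also the drop of the row itself,
  as a word, from \<open>y\<close>; so the rows are ordered as \<open>b0\<close> and \<open>a1\<close> are.
\<close>

lemma word_edges_alternation_free:
  assumes x: "(x, a1) \<in> word_edges m K" "(x, a2) \<in> word_edges m K" "(x, y) \<in> word_edges m K"
    and x': "(x', b0) \<in> word_edges m K" "(x', b1) \<in> word_edges m K" "(x', y) \<in> word_edges m K"
    and cols: "radix m b0 < radix m a1" "radix m a1 < radix m b1"
      "radix m b1 < radix m a2" "radix m a2 < radix m y"
  shows "radix m x' \<le> radix m x"
proof (cases "x = x'")
  case False
  obtain i j where ij: "j < i" "i < m" "y = bump m x i j"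
    and P: "\<And>a. (x, a) \<in> word_edges m K \<Longrightarrow> radix m a < radix m y \<Longrightarrow>
      a \<in> words m K \<and> (\<exists>P \<in> profiles m x i j. drops y a P)"
    using word_edge_profiles[OF x(3)] by metis
  obtain i' j' where ij': "j' < i'" "i' < m" "y = bump m x' i' j'" and w': "x' \<in> words m K"
    and P': "\<And>a. (x', a) \<in> word_edges m K \<Longrightarrow> radix m a < radix m y \<Longrightarrow>
      a \<in> words m K \<and> (\<exists>P \<in> profiles m x' i' j'. drops y a P)"
    using word_edge_profiles[OF x'(3)] by metis
  obtain A1 A2 where A: "A1 \<in> profiles m x i j" "drops y a1 A1" "A2 \<in> profiles m x i j" "drops y a2 A2"
    and a: "a1 \<in> words m K" "a2 \<in> words m K"
    using P[OF x(1)] P[OF x(2)] cols by auto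
  obtain B0 B1 where B: "B0 \<in> profiles m x' i' j'" "drops y b0 B0" "B1 \<in> profiles m x' i' j'" "drops y b1 B1"
    and b: "b0 \<in> words m K" "b1 \<in> words m K"
    using P'[OF x'(1)] P'[OF x'(2)] cols by auto
  have disj: "profiles m x i j \<inter> profiles m x' i' j' = {}"
    using common_column_profiles_disjoint[of m x i j x' i' j'] ij ij' False by simp
  have fst: "fst Q \<le> m" if "Q \<in> profiles m x i j \<union> profiles m x' i' j'" for Q
    using that ij ij' by (auto simp: profiles_def)
  have "A1 < B0"
    using larger_drop_less[OF a(1) A(2) B(2)] fst[of A1] cols(1) A(1) B(1) disj
    by (metis IntI UnI1 empty_iff linorder_neqE not_less_iff_gr_or_eq)
  moreover have "B1 < A1"
    using larger_drop_less[OF b(2) B(4) A(2)] fst[of B1] cols(2) A(1) B(3) disj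
    by (metis IntI UnI2 empty_iff linorder_neqE not_less_iff_gr_or_eq)
  moreover have "A2 < B1"
    using larger_drop_less[OF a(2) A(4) B(4)] fst[of A2] cols(3) A(3) B(3) disj
    by (metis IntI UnI1 empty_iff linorder_neqE not_less_iff_gr_or_eq)
  ultimately have "B1 < B0" "A2 < A1" "A1 < B0"
    by auto
  then have "A1 = (i, m + checksum m i x)" "B0 = (i', m + checksum m i' x')"
    using A(1,3) B(1,3) ij ij' by (auto simp: profiles_def less_prod_def')
  then have "radix m x' < radix m x"
    using larger_drop_less[OF w', of y B0 x A1] row_drops[of j i m x] row_drops[of j' i' m x']
      ij ij' \<open>A1 < B0\<close> by simp
  then show ?thesis
    by simp
qed simp

section \<open>The number of edges\<close>

lemma bounded_word_iff:
  "x \<in> (\<Pi>\<^sub>E k\<in>{..m}. {..<g k}) \<longleftrightarrow> (\<forall>k\<le>m. x k < g k) \<and> (\<forall>k>m. x k = undefined)"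
  for g :: "nat \<Rightarrow> nat"
  by (auto simp: PiE_iff extensional_def)

lemma finite_word_edges: "finite (word_edges m K)"
proof (rule finite_subset)
  show "word_edges m K \<subseteq> words m K \<times> words m K"
    by (auto simp: word_edges_def)
  show "finite (words m K \<times> words m K)"
    by (simp add: words_def finite_PiE)
qed

text \<open>
  Words whose digits \<open>i\<close> and \<open>j\<close> lie in the lower half of their range, so that bumping them cannot
  overflow.  For distinct positions \<open>i, j < m\<close> these are a quarter of all words.
\<close>

definition roomy :: "nat \<Rightarrow> nat \<Rightarrow> nat \<Rightarrow> nat \<Rightarrow> (nat \<Rightarrow> nat) set" where
  "roomy m K i j = {x \<in> words m K. x i < 2 * m\<^sup>2 \<and> x j < 2 * m\<^sup>2}"

lemma card_roomy:
  assumes "j < i" "i < m"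
  shows "4 * card (roomy m K i j) = K * base m ^ m"
proof -
  let ?g = "\<lambda>k. if k = i \<or> k = j then 2 * m\<^sup>2 else digits m K k"
  have "roomy m K i j = (\<Pi>\<^sub>E k\<in>{..m}. {..<?g k})"
  proof (rule set_eqI)
    fix x
    have "(\<forall>k\<le>m. x k < ?g k) \<longleftrightarrow> (\<forall>k\<le>m. x k < digits m K k) \<and> x i < 2 * m\<^sup>2 \<and> x j < 2 * m\<^sup>2"
      (is "?L \<longleftrightarrow> ?R")
    proof
      have small: "?g k \<le> digits m K k" for k
        using assms by (auto simp: digits_def base_def)
      assume L: ?L
      then show ?R
        using L[rule_format, of i] L[rule_format, of j] small assms by (auto intro: less_le_trans)
    qed auto
    then show "x \<in> roomy m K i j \<longleftrightarrow> x \<in> (\<Pi>\<^sub>E k\<in>{..m}. {..<?g k})"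
      unfolding roomy_def mem_Collect_eq words_def bounded_word_iff by blast
  qed
  then have "card (roomy m K i j) = (\<Prod>k\<le>m. ?g k)"
    by (simp add: card_PiE)
  moreover have "(\<Prod>k\<le>m. if k = i \<or> k = j then 2 else 1 :: nat) = 4"
  proof -
    have "{..m} \<inter> {k. k = i \<or> k = j} = {i, j}"
      using assms by auto
    then show ?thesis
      using assms by (simp add: prod.If_cases)
  qed
  ultimately have "4 * card (roomy m K i j) = (\<Prod>k\<le>m. (if k = i \<or> k = j then 2 else 1) * ?g k)"
    by (simp only: prod.distrib)
  also have "\<dots> = (\<Prod>k\<le>m. digits m K k)"
    using assms by (intro prod.cong) (auto simp: digits_def base_def)
  also have "\<dots> = K * base m ^ m"
    by (simp add: digits_def lessThan_Suc_atMost[symmetric])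
  finally show ?thesis .
qed

lemma bump_roomy:
  assumes x: "x \<in> roomy m K i j" and ij: "j < i" "i < m"
  shows "(x, bump m x i j) \<in> word_edges m K"
proof -
  have w: "x \<in> words m K" and room: "x i < 2 * m\<^sup>2" "x j < 2 * m\<^sup>2"
    using x by (auto simp: roomy_def)
  have "m \<le> m\<^sup>2"
    using ij by (simp add: power2_eq_square)
  moreover have "checksum m i x < m\<^sup>2"
    using ij by (simp add: checksum_def)
  ultimately have "x i + m + checksum m i x < base m" "x j + i < base m"
    using room ij unfolding base_def by linarith+
  then have "bump m x i j \<in> words m K"
    using w[unfolded words_def bounded_word_iff] word_digit[OF w, of m] word_low_digit[OF w] ij
    unfolding words_def bounded_word_iff by (auto simp: bump_def digits_def)
  then show ?thesis
    using w ij by (auto simp: word_edges_def)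
qed

lemma bump_inj:
  assumes "bump m x i j = bump m x i' j'" "j < i" "i < m" "j' < i'" "i' < m"
  shows "i = i' \<and> j = j'"
proof -
  have "i = i'"
    using fun_cong[OF assms(1), of i] fun_cong[OF assms(1), of i'] assms(2-)
    by (cases i i' rule: linorder_cases) (auto simp: bump_def)
  then show ?thesis
    using fun_cong[OF assms(1), of j] assms(2-) by (auto simp: bump_def split: if_splits)
qed

lemma card_word_edges: "K * base m ^ m * (m * (m - 1)) \<le> 8 * card (word_edges m K)"
proof -
  let ?P = "SIGMA i:{..<m}. {..<i}"
  let ?S = "SIGMA p:?P. roomy m K (fst p) (snd p)"
  let ?f = "\<lambda>(p, x). (x, bump m x (fst p) (snd p))"
  have fin: "finite (roomy m K i j)" for i j
    by (rule finite_subset[of _ "words m K"]) (auto simp: roomy_def words_def finite_PiE)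
  have "2 * (\<Sum>i<m. i) = m * (m - 1)"
  proof (induction m)
    case (Suc m)
    then show ?case by (cases m) auto
  qed simp
  then have "2 * card ?P = m * (m - 1)"
    by simp
  then have "K * base m ^ m * (m * (m - 1)) = 2 * (\<Sum>p\<in>?P. K * base m ^ m)"
    by simp
  also have "\<dots> = 2 * (\<Sum>p\<in>?P. 4 * card (roomy m K (fst p) (snd p)))"
    by (intro arg_cong[of _ _ "(*) 2"] sum.cong) (auto simp: card_roomy)
  also have "\<dots> = 8 * card ?S"
    using fin by (simp add: sum_distrib_left[symmetric] del: sum_distrib_left)
  also have "card ?S \<le> card (word_edges m K)"
  proof (rule card_inj_on_le)
    show "inj_on ?f ?S"
      by (auto intro!: inj_onI dest: bump_inj)
    show "?f ` ?S \<subseteq> word_edges m K"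
      by (auto intro: bump_roomy)
  qed (rule finite_word_edges)
  finally show ?thesis
    by simp
qed

text \<open>
  Given \<open>n\<close>, the largest \<open>m\<close> with \<open>2 * base m ^ m \<le> n\<close> is taken, and then the largest \<open>K\<close>.  The number
  of edges is at least \<open>n * m * (m - 1) / 32\<close>, whereas \<open>ln n\<close> is only of order \<open>m * ln m\<close>.
\<close>

lemma dense_word_edges:
  "\<forall>\<^sub>F n in sequentially. \<exists>m K. 2 * (K * base m ^ m) \<le> n \<and>
     C * (real n * ln (real n)) \<le> real (card (word_edges m K))"
proof -
  define size where "size m = 2 * base m ^ m" for m
  let ?g = "\<lambda>m::nat. real m * (real m - 1) / 32 / (ln 2 + (real m + 1) * ln (4 * (real m + 1)\<^sup>2))"
  have "filterlim ?g at_top sequentially"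
    by real_asymp
  then have "\<forall>\<^sub>F m in sequentially. C \<le> ?g m"
    by (simp add: filterlim_at_top)
  then obtain m0 where m0: "\<And>m. m \<ge> m0 \<Longrightarrow> C \<le> ?g m"
    by (auto simp: eventually_sequentially)
  have size_mono: "size a \<le> size b" if "a \<le> b" "1 \<le> a" for a b
  proof -
    have "base a ^ a \<le> base b ^ a"
      using that by (intro power_mono) (auto simp: base_def)
    also have "\<dots> \<le> base b ^ b"
      using that by (intro power_increasing) (auto simp: base_def Suc_le_eq)
    finally show ?thesis
      by (simp add: size_def)
  qed
  have size_gt: "n < size (Suc n)" for n
  proof -
    have "n < 2 ^ Suc n"
      by (rule less_trans[OF less_exp]) simp
    also have "\<dots> \<le> base (Suc n) ^ Suc n"
      by (intro power_mono) (auto simp: base_def power2_eq_square)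
    finally show ?thesis
      by (simp add: size_def)
  qed
  have "\<exists>m K. 2 * (K * base m ^ m) \<le> n \<and> C * (real n * ln (real n)) \<le> real (card (word_edges m K))"
    if n: "n \<ge> size (Suc m0)" for n
  proof -
    define m where "m = (LEAST m. n < size (Suc m))"
    have upper: "n < size (Suc m)"
      unfolding m_def using size_gt by (rule LeastI)
    have "m > m0"
      using size_mono[of "Suc m" "Suc m0"] upper n by (cases "m \<le> m0") auto
    then have "\<not> n < size (Suc (m - 1))"
      unfolding m_def[symmetric] using not_less_Least[of "m - 1" "\<lambda>m. n < size (Suc m)"]
      by (simp add: m_def[symmetric])
    then have lower: "size m \<le> n"
      using \<open>m > m0\<close> by simp
    define N where "N = base m ^ m"
    define K where "K = n div (2 * N)"
    have N: "0 < N"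
      using \<open>m > m0\<close> by (simp add: N_def base_def)
    have "1 \<le> K"
      using lower N by (simp add: K_def N_def size_def Suc_le_eq div_greater_zero_iff)
    have fits: "2 * (K * N) \<le> n"
      unfolding K_def by (metis mult.assoc mult.commute div_times_less_eq_dividend)
    have "n < 2 * N + K * (2 * N)"
      using N dividend_less_div_times[of "2 * N" n] by (simp add: K_def)
    also have "\<dots> \<le> K * (2 * N) + K * (2 * N)"
      using \<open>1 \<le> K\<close> by simp
    finally have "real n \<le> 4 * real (K * N)"
      by (metis (no_types, opaque_lifting) add_mult_distrib less_imp_le mult.commute
          mult.left_commute mult_2 numeral_Bit0 of_nat_le_iff of_nat_mult of_nat_numeral)
    then have "real n * (real m * (real m - 1)) \<le> 4 * real (K * N) * (real m * (real m - 1))"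
      using \<open>m > m0\<close> by (intro mult_right_mono) auto
    also have "\<dots> = 4 * real (K * N * (m * (m - 1)))"
      using \<open>m > m0\<close> by (simp add: of_nat_diff)
    also have "\<dots> \<le> 4 * real (8 * card (word_edges m K))"
      unfolding N_def by (intro mult_left_mono of_nat_mono card_word_edges) auto
    finally have edges: "real n * (real m * (real m - 1) / 32) \<le> real (card (word_edges m K))"
      by simp
    have "1 \<le> n"
      using lower N unfolding size_def N_def by linarith
    have "ln (real n) \<le> ln (real (size (Suc m)))"
      using upper \<open>1 \<le> n\<close> by (intro ln_mono) auto
    also have "\<dots> = ln (2 * (4 * (real m + 1)\<^sup>2) ^ Suc m)"
      by (simp add: size_def base_def add.commute)
    also have "\<dots> = ln 2 + ln ((4 * (real m + 1)\<^sup>2) ^ Suc m)"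
      by (intro ln_mult_pos zero_less_power mult_pos_pos) auto
    also have "\<dots> = ln 2 + (real m + 1) * ln (4 * (real m + 1)\<^sup>2)"
      by (subst ln_realpow) (auto simp: add.commute)
    finally have log: "ln (real n) \<le> ln 2 + (real m + 1) * ln (4 * (real m + 1)\<^sup>2)" (is "_ \<le> ?d") .
    have "1 \<le> (real m + 1)\<^sup>2"
      by (intro one_le_power) auto
    then have "1 \<le> 4 * (real m + 1)\<^sup>2"
      by linarith
    then have "0 < ?d"
      by (intro add_pos_nonneg mult_nonneg_nonneg ln_ge_zero) auto
    have "0 \<le> ?g m"
      using \<open>0 < ?d\<close> \<open>m > m0\<close> by (intro divide_nonneg_pos) auto
    have "C * ln (real n) \<le> ?g m * ln (real n)"
      using m0[of m] \<open>m > m0\<close> \<open>1 \<le> n\<close> by (intro mult_right_mono) auto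
    also have "\<dots> \<le> ?g m * ?d"
      using log \<open>0 \<le> ?g m\<close> by (intro mult_left_mono)
    also have "\<dots> = real m * (real m - 1) / 32"
      by (rule nonzero_eq_divide_eq[THEN iffD1, OF _ refl]) (use \<open>0 < ?d\<close> in linarith)
    finally have "real n * (C * ln (real n)) \<le> real n * (real m * (real m - 1) / 32)"
      by (intro mult_left_mono) auto
    then have "C * (real n * ln (real n)) \<le> real (card (word_edges m K))"
      using edges by (simp add: algebra_simps)
    then show ?thesis
      using fits unfolding N_def by blast
  qed
  then show ?thesis
    by (auto simp: eventually_sequentially)
qed

section \<open>Cycles and copies in digraphs\<close>

lemma transitive_setI:
  fixes G :: "'a::order pair_pre_digraph"
  assumes "S \<subseteq> pverts G" and up: "\<And>u v. (u, v) \<in> parcs G \<Longrightarrow> u \<in> S \<Longrightarrow> v \<in> S \<Longrightarrow> u < v"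
  shows "transitive_set G S"
proof -
  let ?D = "with_proj G \<restriction> S"
  have up_walk: "u \<le> v \<and> (p \<noteq> [] \<longrightarrow> u < v)" if "pre_digraph.cas ?D u p v" "set p \<subseteq> arcs ?D" for u p v
    using that
  proof (induction p arbitrary: u)
    case (Cons e p)
    then have "fst e < snd e" "fst e = u" "pre_digraph.cas ?D (snd e) p v"
      by (auto simp: pre_digraph.cas.simps intro: up)
    then show ?case
      using Cons.IH[of "snd e"] Cons.prems by auto
  qed (simp add: pre_digraph.cas.simps)
  then have "\<not> pre_digraph.cycle ?D p" for p
    unfolding pre_digraph.cycle_def pre_digraph.awalk_def by blast
  then show ?thesis
    using assms(1) by (simp add: transitive_set_def)
qed

text \<open>
  A cycle of length at least 3 is a set of vertices each of which has two distinct neighbours in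
  the set, so it is enough to exclude such sets.
\<close>

lemma undirected_forestI:
  assumes sym: "sym (parcs G)"
    and no_core: "\<And>C. C \<noteq> {} \<Longrightarrow>
      \<forall>v\<in>C. \<exists>u\<in>C. \<exists>w\<in>C. u \<noteq> w \<and> (v, u) \<in> parcs G \<and> (v, w) \<in> parcs G \<Longrightarrow> False"
  shows "undirected_forest G"
  unfolding undirected_forest_def
proof (intro notI, elim exE conjE)
  fix p assume "pre_digraph.cycle (with_proj G) p" and len: "3 \<le> length p"
  then obtain u where walk: "pre_digraph.cas (with_proj G) u p u" "set p \<subseteq> parcs G"
    and dist: "distinct (tl (pre_digraph.awalk_verts (with_proj G) u p))"
    by (auto simp: pre_digraph.cycle_def pre_digraph.awalk_def)
  define n where "n = length p"
  have "p \<noteq> []"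
    using len by auto
  have verts: "map fst p @ [snd (last p)] = u # map snd p"
    using pre_digraph.awalk_verts_conv[of "with_proj G" u p]
      pre_digraph.awalk_verts_conv'[OF walk(1)] \<open>p \<noteq> []\<close> walk(1)
    by (cases p) (auto simp: pre_digraph.cas.simps)
  have "distinct (map snd p)"
    using dist pre_digraph.awalk_verts_conv'[OF walk(1)] \<open>p \<noteq> []\<close> by simp
  have "snd (last q) = v" if "pre_digraph.cas (with_proj G) a q v" "q \<noteq> []" for a q v
    using that by (induction q arbitrary: a) (auto simp: pre_digraph.cas.simps)
  then have closed: "snd (last p) = u"
    using walk(1) \<open>p \<noteq> []\<close> by blast
  \<comment> \<open>The tails of the arcs are a rotation of their heads, hence distinct as well.\<close>
  have "mset (map fst p @ [snd (last p)]) = mset (u # map snd p)"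
    using verts by simp
  then have "mset (map fst p) = mset (map snd p)"
    using closed by simp
  then have dfst: "distinct (map fst p)"
    using \<open>distinct (map snd p)\<close> mset_eq_imp_distinct_iff by blast
  \<comment> \<open>The vertices of the cycle, as a periodic sequence.\<close>
  define w where "w k = fst (p ! (k mod n))" for k
  have n: "3 \<le> n" "0 < n"
    using len by (auto simp: n_def)
  have arc: "(w k, w (Suc k)) \<in> parcs G" for k
  proof -
    define i where "i = k mod n"
    have i: "i < n"
      using n by (simp add: i_def)
    have "snd (p ! i) = (u # map snd p) ! Suc i"
      using i by (simp add: n_def)
    also have "\<dots> = (map fst p @ [u]) ! Suc i"
      using verts closed by simp
    also have "\<dots> = fst (p ! (Suc i mod n))"
    proof (cases "Suc i = n")
      case True
      have "u = fst (p ! 0)"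
        using verts \<open>p \<noteq> []\<close> by (cases p) auto
      then show ?thesis
        using True by (simp add: n_def nth_append)
    next
      case False
      then show ?thesis
        using i by (simp add: n_def nth_append)
    qed
    finally have "snd (p ! i) = w (Suc k)"
      by (simp add: w_def i_def mod_Suc_eq)
    moreover have "p ! i \<in> parcs G"
      using walk(2) i by (auto simp: n_def)
    ultimately show ?thesis
      by (metis i_def prod.collapse w_def)
  qed
  have inj: "k mod n = l mod n" if "w k = w l" for k l
    using that dfst n nth_eq_iff_index_eq[of "map fst p" "k mod n" "l mod n"] by (simp add: w_def n_def)
  have "\<exists>a\<in>range w. \<exists>b\<in>range w. a \<noteq> b \<and> (v, a) \<in> parcs G \<and> (v, b) \<in> parcs G" if v: "v \<in> range w" for v
  proof -
    obtain k where k: "v = w k"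
      using v by auto
    have "w (k + n) = w k"
      by (simp add: w_def)
    then have "(w (k + n - 1), v) \<in> parcs G"
      using arc[of "k + n - 1"] n k by simp
    then have "(v, w (k + n - 1)) \<in> parcs G"
      using sym by (auto dest: symD)
    moreover have "w (Suc k) \<noteq> w (k + n - 1)"
    proof
      assume "w (Suc k) = w (k + n - 1)"
      then have "n dvd (k + n - 1) - Suc k"
        using inj[of "k + n - 1" "Suc k"] n by (subst mod_eq_dvd_iff_nat[symmetric]) auto
      then have "n dvd n - 2"
        by simp
      then show False
        using n by (auto dest: dvd_imp_le)
    qed
    ultimately show ?thesis
      using arc[of k] k by blast
  qed
  then show False
    using no_core[of "range w"] by blast
qed

lemma contains_copyE:
  assumes "contains_copy D H"
  obtains f where "inj_on f (pverts H)" "\<And>u v. (u, v) \<in> parcs H \<Longrightarrow> (f u, f v) \<in> parcs D"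
proof -
  obtain S h where S: "subgraph S (with_proj D)"
    and h: "pre_digraph.digraph_isomorphism (with_proj H) h" "S = app_iso h (with_proj H)"
    using assms by (auto simp: contains_copy_def digraph_iso_def)
  have ends: "tail S = fst" "head S = snd" and "arcs S \<subseteq> parcs D"
    using S by (auto simp: subgraph_def compatible_def)
  have "inj_on (iso_verts h) (pverts H)"
    using h(1) by (simp add: pre_digraph.digraph_isomorphism_def)
  moreover have "(iso_verts h u, iso_verts h v) \<in> parcs D" if "(u, v) \<in> parcs H" for u v
  proof -
    have "iso_verts h u = fst (iso_arcs h (u, v))" "iso_verts h v = snd (iso_arcs h (u, v))"
      using h that ends by (auto simp: pre_digraph.digraph_isomorphism_def)
    moreover have "iso_arcs h (u, v) \<in> arcs S"
      using h(2) that by simp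
    ultimately show ?thesis
      using \<open>arcs S \<subseteq> parcs D\<close> by auto
  qed
  ultimately show thesis
    using that by blast
qed

text \<open>
  The hypothesis speaks about \<open>B\<close> only, but it is inherited by all subsets of \<open>B\<close>, so no number
  of edges up to \<open>card B\<close> forces a copy of \<open>H\<close>.
\<close>

lemma card_less_t_trans:
  assumes sub: "B \<subseteq> (parcs (trans_tournament n))\<inverse>"
    and free: "\<And>f. inj_on f (pverts H) \<Longrightarrow>
      (\<And>u v. (u, v) \<in> parcs H \<Longrightarrow> f u < f v \<or> (f u, f v) \<in> B) \<Longrightarrow> False"
  shows "card B < t_trans n H"
proof -
  let ?forces = "\<lambda>t. \<forall>B. B \<subseteq> (parcs (trans_tournament n))\<inverse> \<and> card B = t \<longrightarrow>
     contains_copy (add_edges (trans_tournament n) B) H"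
  let ?A = "(parcs (trans_tournament n))\<inverse>"
  have "finite ?A"
    by (rule finite_subset[of _ "{..<n} \<times> {..<n}"]) (auto simp: trans_tournament_def)
  \<comment> \<open>The least element exists, since more edges than \<open>?A\<close> has cannot be added at all.\<close>
  then have "?forces (Suc (card ?A))"
    by (metis card_mono not_less_eq_eq order_refl)
  then have forces: "?forces (t_trans n H)"
    unfolding t_trans_def by (rule LeastI)
  show ?thesis
  proof (rule ccontr)
    assume "\<not> card B < t_trans n H"
    then obtain B' where B': "B' \<subseteq> B" "card B' = t_trans n H"
      by (meson not_less obtain_subset_with_card_n)
    then have "contains_copy (add_edges (trans_tournament n) B') H"
      using forces sub by blast
    then obtain f where f: "inj_on f (pverts H)"
      "\<And>u v. (u, v) \<in> parcs H \<Longrightarrow> (f u, f v) \<in> parcs (add_edges (trans_tournament n) B')"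
      using contains_copyE by blast
    have "f u < f v \<or> (f u, f v) \<in> B" if "(u, v) \<in> parcs H" for u v
      using f(2)[OF that] B'(1) by (auto simp: add_edges_def trans_tournament_def)
    then show False
      using free f(1) by blast
  qed
qed

section \<open>A tournament forest from five copies of the pattern\<close>

text \<open>
  The pattern of \<open>word_edges_alternation_free\<close>: two rows 0 and 1, and the columns
  \<open>b0, a1, b1, a2, y\<close> numbered from 0 to 4.
\<close>

definition pattern :: "(nat \<times> nat) set" where
  "pattern = {(0, 1), (0, 3), (0, 4), (1, 0), (1, 2), (1, 4)}"

text \<open>
  The tournament is made of five copies \<open>t < 5\<close> of the pattern.  Its first ten vertices are the rows
  of all copies, its other 25 vertices are the columns of all copies, and an arc leads from a
  smaller vertex to a larger one unless the pattern reverses it.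
\<close>

definition row :: "nat \<Rightarrow> nat \<Rightarrow> nat" where
  "row t s = 2 * t + s"

definition col :: "nat \<Rightarrow> nat \<Rightarrow> nat" where
  "col t c = 10 + 5 * t + c"

definition back_arcs :: "(nat \<times> nat) set" where
  "back_arcs = {(col t c, row t s) | t s c. t < 5 \<and> (s, c) \<in> pattern}"

definition witness :: "nat pair_pre_digraph" where
  "witness = \<lparr> pverts = {..<35},
     parcs = {(u, v). u < v \<and> v < 35 \<and> (v, u) \<notin> back_arcs} \<union> back_arcs \<rparr>"

lemma pattern_bounds: "(s, c) \<in> pattern \<Longrightarrow> s < 2 \<and> c < 5"
  by (auto simp: pattern_def)

lemma back_arcs_bounds: "(v, u) \<in> back_arcs \<Longrightarrow> u < 10 \<and> 10 \<le> v \<and> v < 35"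
  by (auto simp: back_arcs_def row_def col_def dest!: pattern_bounds)

lemma back_arcsE:
  assumes "(v, u) \<in> back_arcs"
  obtains t s c where "t < 5" "(s, c) \<in> pattern" "v = col t c" "u = row t s"
  using assms by (auto simp: back_arcs_def)

lemma col_eq_iff: "c < 5 \<Longrightarrow> c' < 5 \<Longrightarrow> col t c = col t' c' \<longleftrightarrow> t = t' \<and> c = c'"
  by (cases t t' rule: linorder_cases) (auto simp: col_def)

lemma row_eq_iff: "s < 2 \<Longrightarrow> s' < 2 \<Longrightarrow> row t s = row t' s' \<longleftrightarrow> t = t' \<and> s = s'"
  by (cases t t' rule: linorder_cases) (auto simp: row_def)

lemma back_arc_iff:
  assumes "s < 2" "c < 5"
  shows "(col t c, row t' s) \<in> back_arcs \<longleftrightarrow> t < 5 \<and> t = t' \<and> (s, c) \<in> pattern"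
proof
  assume "(col t c, row t' s) \<in> back_arcs"
  then obtain t'' s'' c'' where e: "col t c = col t'' c''" "row t' s = row t'' s''" "t'' < 5" "(s'', c'') \<in> pattern"
    by (auto simp: back_arcs_def)
  then have "t = t''" "c = c''" "t' = t''" "s = s''"
    using assms pattern_bounds[OF e(4)] by (auto simp: col_eq_iff row_eq_iff)
  then show "t < 5 \<and> t = t' \<and> (s, c) \<in> pattern"
    using e by simp
qed (auto simp: back_arcs_def)

text \<open>
  The five copies have no edges between them, and in each of them only the column 4 is adjacent
  to both rows: a set of vertices having two neighbours each within the set would contain no other columns,
  hence no rows, hence nothing.
\<close>

lemma witness_forest: "tournament_forest witness"
proof -
  let ?L = "{..<10::nat}" and ?R = "{10..<35::nat}"
  have "finite (parcs witness)"
    by (rule finite_subset[of _ "{..<35} \<times> {..<35}"]) (auto simp: witness_def dest: back_arcs_bounds)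
  then have "pair_digraph witness"
    by unfold_locales (auto simp: witness_def dest: back_arcs_bounds)
  then have "tournament witness"
    by (force simp: tournament_def witness_def dest: back_arcs_bounds)
  moreover have "transitive_set witness ?L"
    by (rule transitive_setI) (auto simp: witness_def dest: back_arcs_bounds)
  moreover have "transitive_set witness ?R"
    by (rule transitive_setI) (auto simp: witness_def dest: back_arcs_bounds)
  moreover have "undirected_forest (back_graph witness ?L ?R)"
  proof -
    have arcs: "parcs (back_graph witness ?L ?R) = back_arcs \<union> back_arcs\<inverse>"
    proof -
      have "{(r, l). r \<in> ?R \<and> l \<in> ?L \<and> (r, l) \<in> parcs witness} = back_arcs"
        by (auto simp: witness_def dest: back_arcs_bounds)
      then show ?thesis
        unfolding back_graph_def parcs_mk_symmetric with_proj_simps pair_pre_digraph.simps by force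
    qed
    show ?thesis
    proof (rule undirected_forestI, unfold arcs)
      fix C assume "C \<noteq> {}"
        and core: "\<forall>v\<in>C. \<exists>u\<in>C. \<exists>w\<in>C. u \<noteq> w \<and> (v, u) \<in> back_arcs \<union> back_arcs\<inverse>
          \<and> (v, w) \<in> back_arcs \<union> back_arcs\<inverse>"
      have shared: "\<exists>t. v = col t 4" if v: "v \<in> C" "10 \<le> v" for v
      proof -
        obtain u w where "u \<noteq> w" "(v, u) \<in> back_arcs" "(v, w) \<in> back_arcs"
          using core v by (auto dest!: bspec[OF _ v(1)] dest: back_arcs_bounds)
        then obtain t s c t' s' c' where "v = col t c" "u = row t s" "(s, c) \<in> pattern"
          "v = col t' c'" "w = row t' s'" "(s', c') \<in> pattern"
          by (metis back_arcsE)
        moreover from this have "t = t'" "c = c'"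
          using pattern_bounds[of s c] pattern_bounds[of s' c'] by (auto simp: col_eq_iff)
        ultimately show ?thesis
          using \<open>u \<noteq> w\<close> by (auto simp: pattern_def)
      qed
      have no_row: False if v: "v \<in> C" "v < 10" for v
      proof -
        obtain u w where uw: "u \<noteq> w" "u \<in> C" "w \<in> C" "(u, v) \<in> back_arcs" "(w, v) \<in> back_arcs"
          using core v by (auto dest!: bspec[OF _ v(1)] dest: back_arcs_bounds)
        then obtain t t' where t: "u = col t 4" "w = col t' 4"
          using shared back_arcs_bounds by metis
        obtain t'' s where v: "v = row t'' s" "s < 2"
          using uw(4) pattern_bounds by (auto simp: back_arcs_def)
        have "t = t''" "t' = t''"
          using uw(4,5) back_arc_iff[OF v(2), of 4] unfolding t v(1) by auto
        then show False
          using t uw(1) by simp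
      qed
      obtain v where v: "v \<in> C"
        using \<open>C \<noteq> {}\<close> by auto
      then obtain u where "u \<in> C" "(v, u) \<in> back_arcs \<union> back_arcs\<inverse>"
        using core by blast
      then have "u < 10 \<or> v < 10"
        by (auto dest: back_arcs_bounds)
      then show False
        using no_row v \<open>u \<in> C\<close> by blast
    qed (auto simp: sym_def)
  qed
  moreover have "?L \<union> ?R = pverts witness" "?L \<inter> ?R = {}"
    by (auto simp: witness_def)
  ultimately show ?thesis
    unfolding tournament_forest_def by blast
qed

lemma witness_arcI: "u < v \<Longrightarrow> v < 35 \<Longrightarrow> (v, u) \<notin> back_arcs \<Longrightarrow> (u, v) \<in> parcs witness"
  by (simp add: witness_def)

lemma witness_back_arcI: "(v, u) \<in> back_arcs \<Longrightarrow> (v, u) \<in> parcs witness"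
  by (simp add: witness_def)

lemma two_outside:
  obtains t t' :: nat where "t < t'" "t' < 5" "t \<notin> {a, b, c}" "t' \<notin> {a, b, c}"
proof -
  let ?S = "{..<5} - {a, b, c}"
  have "card {a, b, c} \<le> 3"
    by (auto simp: card_insert_if)
  then have "\<not> card ?S \<le> Suc 0"
    using diff_card_le_card_Diff[of "{a, b, c}" "{..<5}"] by simp
  then obtain t t' where "t \<in> ?S" "t' \<in> ?S" "t \<noteq> t'"
    using card_le_Suc0_iff_eq[of ?S] by auto
  then show thesis
    using that[of t t'] that[of t' t] by (cases t t' rule: linorder_cases) auto
qed

text \<open>
  The threshold \<open>T\<close> separates the rows from the columns of the host, so an embedding splits the
  vertices of the tournament into a left side, mapped to rows, and a right side, mapped to columns.
  If a copy has its rows on the left and its columns on the right, it embeds the forbidden pattern.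
  Otherwise each copy has a row on the right or a column on the left.  Two copies with columns on
  the left give a directed triangle on the left if the rows of the later copy are there too: these
  two columns and a row adjacent to the later one.  Two copies with rows on the right give a directed
  triangle on the right in the same way, if the columns of the earlier copy are there.  Such triangles
  are impossible, since arcs within a side go up.  Finally, two rows on the right and two columns
  on the left, none adjacent in the pattern, embed a 4-cycle.  With five copies, one of these
  cases occurs.
\<close>

lemma witness_not_embeddable:
  fixes f :: "nat \<Rightarrow> nat"
  assumes split: "\<And>c r. (c, r) \<in> B \<Longrightarrow> r < T \<and> T \<le> c"
    and four_cycle_free: "\<And>c c' r r'. (c, r) \<in> B \<Longrightarrow> (c, r') \<in> B \<Longrightarrow> (c', r) \<in> B \<Longrightarrow> (c', r') \<in> B \<Longrightarrow>
      r \<noteq> r' \<Longrightarrow> c = c'"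
    and alternation_free: "\<And>x x' b0 a1 b1 a2 y. (a1, x) \<in> B \<Longrightarrow> (a2, x) \<in> B \<Longrightarrow> (y, x) \<in> B \<Longrightarrow>
      (b0, x') \<in> B \<Longrightarrow> (b1, x') \<in> B \<Longrightarrow> (y, x') \<in> B \<Longrightarrow>
      b0 < a1 \<Longrightarrow> a1 < b1 \<Longrightarrow> b1 < a2 \<Longrightarrow> a2 < y \<Longrightarrow> x' \<le> x"
    and inj: "inj_on f (pverts witness)"
    and emb: "\<And>u v. (u, v) \<in> parcs witness \<Longrightarrow> f u < f v \<or> (f u, f v) \<in> B"
  shows False
proof -
  define L where "L v \<longleftrightarrow> f v < T" for v
  have same_side: "f u < f v" if "(u, v) \<in> parcs witness" "L u = L v" for u v
    using emb[OF that(1)] that(2) split[of "f u" "f v"] by (auto simp: L_def)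
  have cross: "(f u, f v) \<in> B" if "(u, v) \<in> parcs witness" "\<not> L u" "L v" for u v
    using emb[OF that(1)] that(2,3) by (auto simp: L_def)
  have no_triangle: False
    if "(u, v) \<in> parcs witness" "(v, w) \<in> parcs witness" "(w, u) \<in> parcs witness"
      "L u = L v" "L v = L w" for u v w
    using same_side[OF that(1)] same_side[OF that(2)] same_side[OF that(3)] that(4,5) by simp
  have no_swap: False
    if bounds: "b < 10" "b' < 10" "b \<noteq> b'" "10 \<le> a" "a < 35" "10 \<le> a'" "a' < 35" "a \<noteq> a'"
      and sides: "\<not> L b" "\<not> L b'" "L a" "L a'"
      and forward: "\<And>v u. v \<in> {a, a'} \<Longrightarrow> u \<in> {b, b'} \<Longrightarrow> (v, u) \<notin> back_arcs"
    for a a' b b'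
  proof -
    have "(f u, f v) \<in> B" if "v \<in> {a, a'}" "u \<in> {b, b'}" for u v
      using that bounds sides forward[of v u] by (intro cross witness_arcI) auto
    moreover have "f a \<noteq> f a'" "f b \<noteq> f b'"
      using inj bounds by (auto simp: witness_def inj_on_def)
    ultimately show False
      using four_cycle_free[of "f b" "f a" "f a'" "f b'"] by auto
  qed
  have no_upright_copy: False
    if "t < 5" and rows: "\<And>s. s < 2 \<Longrightarrow> L (row t s)" and cols: "\<And>c. c < 5 \<Longrightarrow> \<not> L (col t c)" for t
  proof -
    have copy_edge: "(f (col t c), f (row t s)) \<in> B" if "(s, c) \<in> pattern" for s c
      using that pattern_bounds[OF that] \<open>t < 5\<close> rows cols
      by (intro cross witness_back_arcI) (auto simp: back_arc_iff)
    have col_mono: "f (col t c) < f (col t c')" if "c < c'" "c' < 5" for c c'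
    proof (rule same_side)
      show "(col t c, col t c') \<in> parcs witness"
        using that \<open>t < 5\<close> by (intro witness_arcI) (auto simp: col_def dest: back_arcs_bounds)
    qed (use that cols in auto)
    have "f (row t 0) < f (row t 1)"
    proof (rule same_side)
      show "(row t 0, row t 1) \<in> parcs witness"
        using \<open>t < 5\<close> by (intro witness_arcI) (auto simp: row_def dest: back_arcs_bounds)
    qed (use rows in auto)
    moreover have "f (row t 1) \<le> f (row t 0)"
      by (rule alternation_free[of "f (col t 1)" _ "f (col t 3)" "f (col t 4)" "f (col t 0)" _ "f (col t 2)"])
        (auto intro!: copy_edge col_mono simp: pattern_def)
    ultimately show False
      by simp
  qed
  have low_row: "row t s < 10" if "t < 5" "s < 2" for t s
    using that by (simp add: row_def)
  have high_col: "10 \<le> col t c" "col t c < 35" if "t < 5" "c < 5" for t c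
    using that by (auto simp: col_def)
  have no_left_columns: False
    if "t' < t" "t < 5" "c < 5" "c' < 5" "L (col t c)" "L (col t' c')"
      and rows: "\<And>s. s < 2 \<Longrightarrow> L (row t s)" for t t' c c'
  proof -
    obtain s where s: "(s, c) \<in> pattern" "s < 2"
      using \<open>c < 5\<close> by (auto simp: pattern_def less_Suc_eq numeral_eq_Suc)
    show False
    proof (rule no_triangle)
      show "(row t s, col t' c') \<in> parcs witness"
        using that s low_row[of t s] high_col[of t' c']
        by (intro witness_arcI) (auto simp: back_arc_iff)
      show "(col t' c', col t c) \<in> parcs witness"
        using that high_col[of t c] by (intro witness_arcI) (auto simp: col_def dest: back_arcs_bounds)
      show "(col t c, row t s) \<in> parcs witness"
        using that s by (intro witness_back_arcI) (simp add: back_arc_iff)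
    qed (use that s in auto)
  qed
  have no_right_rows: False
    if "t < t'" "t' < 5" "s < 2" "s' < 2" "\<not> L (row t s)" "\<not> L (row t' s')"
      and cols: "\<And>c. c < 5 \<Longrightarrow> \<not> L (col t c)" for t t' s s'
  proof -
    obtain c where c: "(s, c) \<in> pattern" "c < 5"
      using \<open>s < 2\<close> by (auto simp: pattern_def less_Suc_eq numeral_eq_Suc)
    show False
    proof (rule no_triangle)
      show "(row t s, row t' s') \<in> parcs witness"
        using that low_row[of t' s'] by (intro witness_arcI) (auto simp: row_def dest: back_arcs_bounds)
      show "(row t' s', col t c) \<in> parcs witness"
        using that c low_row[of t' s'] high_col[of t c]
        by (intro witness_arcI) (auto simp: back_arc_iff)
      show "(col t c, row t s) \<in> parcs witness"
        using that c by (intro witness_back_arcI) (simp add: back_arc_iff)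
    qed (use that c in auto)
  qed
  show False
  proof (cases "\<exists>t0. \<forall>t<5. t \<noteq> t0 \<longrightarrow> (\<forall>s<2. L (row t s))")
    case True
    \<comment> \<open>All misplaced rows belong to the copy \<open>t0\<close>; the others must have columns on the left.\<close>
    then obtain t0 where rows: "\<And>t s. t < 5 \<Longrightarrow> t \<noteq> t0 \<Longrightarrow> s < 2 \<Longrightarrow> L (row t s)"
      by blast
    obtain t t' where t: "t < t'" "t' < 5" "t \<noteq> t0" "t' \<noteq> t0"
      using two_outside[of t0 t0 t0] by auto
    obtain c c' where "c < 5" "L (col t c)" "c' < 5" "L (col t' c')"
      using no_upright_copy[of t] no_upright_copy[of t'] rows t by (meson less_trans)
    then show False
      using no_left_columns[of t t' c' c] rows t by blast
  next
    case False
    \<comment> \<open>Rows of two copies are misplaced, so columns on the left are confined to one further copy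
      \<open>t3\<close>; each of the two copies that remain must have a row on the right.\<close>
    then obtain t1 s1 where b1: "t1 < 5" "s1 < 2" "\<not> L (row t1 s1)"
      by blast
    obtain t2 s2 where b2: "t2 < 5" "s2 < 2" "\<not> L (row t2 s2)" "t2 \<noteq> t1"
      using False by blast
    have few: "col t c = col t' c'"
      if c: "t < 5" "c < 5" "t \<notin> {t1, t2}" "L (col t c)"
        and c': "t' < 5" "c' < 5" "t' \<notin> {t1, t2}" "L (col t' c')"
      for t c t' c'
    proof (rule ccontr)
      assume ne: "col t c \<noteq> col t' c'"
      have "row t1 s1 \<noteq> row t2 s2"
        using row_eq_iff[OF b1(2) b2(2)] b2(4) by simp
      moreover have "(v, u) \<notin> back_arcs"
        if "v \<in> {col t c, col t' c'}" "u \<in> {row t1 s1, row t2 s2}" for v u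
        using that back_arc_iff[OF b1(2) c(2)] back_arc_iff[OF b2(2) c(2)]
          back_arc_iff[OF b1(2) c'(2)] back_arc_iff[OF b2(2) c'(2)] c(3) c'(3) by blast
      ultimately show False
        using no_swap[OF low_row[OF b1(1,2)] low_row[OF b2(1,2)] _
            high_col[OF c(1,2)] high_col[OF c'(1,2)] ne b1(3) b2(3) c(4) c'(4)] by blast
    qed
    have "\<exists>t3. \<forall>t<5. t \<notin> {t1, t2, t3} \<longrightarrow> (\<forall>c<5. \<not> L (col t c))"
    proof (cases "\<exists>t<5. \<exists>c<5. t \<notin> {t1, t2} \<and> L (col t c)")
      case True
      then obtain t3 c3 where t3: "t3 < 5" "c3 < 5" "t3 \<notin> {t1, t2}" "L (col t3 c3)"
        by blast
      have "t = t3" if "t < 5" "t \<notin> {t1, t2}" "c < 5" "L (col t c)" for t c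
        using few[OF that(1,3,2,4) t3] col_eq_iff[OF that(3) t3(2)] by simp
      then show ?thesis
        by blast
    qed blast
    then obtain t3 where cols: "\<And>t c. t < 5 \<Longrightarrow> t \<notin> {t1, t2, t3} \<Longrightarrow> c < 5 \<Longrightarrow> \<not> L (col t c)"
      by blast
    obtain t t' where t: "t < t'" "t' < 5" "t \<notin> {t1, t2, t3}" "t' \<notin> {t1, t2, t3}"
      by (rule two_outside)
    obtain s s' where "s < 2" "\<not> L (row t s)" "s' < 2" "\<not> L (row t' s')"
      using no_upright_copy[of t] no_upright_copy[of t'] cols t by (meson less_trans)
    then show False
      using no_right_rows[of t t' s s'] cols[of t] t by (meson less_trans)
  qed
qed

section \<open>The lower bound\<close>

text \<open>
  Rows occupy the first block of \<open>K * base m ^ m\<close> vertices of the transitive tournament, columns the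
  second block, so that all these arcs point backwards.
\<close>

definition host_arcs :: "nat \<Rightarrow> nat \<Rightarrow> (nat \<times> nat) set" where
  "host_arcs m K = (\<lambda>(x, y). (K * base m ^ m + radix m y, radix m x)) ` word_edges m K"

lemma card_host_arcs: "card (host_arcs m K) = card (word_edges m K)"
  unfolding host_arcs_def
proof (rule card_image, rule inj_onI)
  fix e e' assume "e \<in> word_edges m K" "e' \<in> word_edges m K"
    "(\<lambda>(x, y). (K * base m ^ m + radix m y, radix m x)) e
      = (\<lambda>(x, y). (K * base m ^ m + radix m y, radix m x)) e'"
  then show "e = e'"
    using inj_onD[OF inj_on_radix[of m K]] by (auto simp: word_edges_def)
qed

lemma word_edges_words: "(x, y) \<in> word_edges m K \<Longrightarrow> x \<in> words m K \<and> y \<in> words m K"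
  by (auto simp: word_edges_def)

lemma host_arcsE:
  assumes "(c, r) \<in> host_arcs m K"
  obtains x y where "(x, y) \<in> word_edges m K" "x \<in> words m K" "y \<in> words m K"
    "c = K * base m ^ m + radix m y" "r = radix m x"
  using assms word_edges_words by (auto simp: host_arcs_def)

lemma host_arcs_split:
  assumes "(c, r) \<in> host_arcs m K"
  shows "r < K * base m ^ m" "K * base m ^ m \<le> c" "c < 2 * (K * base m ^ m)"
  using assms radix_bound by (auto elim!: host_arcsE)

lemma card_word_edges_less_t_trans:
  assumes "2 * (K * base m ^ m) \<le> n"
  shows "card (word_edges m K) < t_trans n witness"
proof -
  have inj: "radix m x = radix m y \<longleftrightarrow> x = y" if "x \<in> words m K" "y \<in> words m K" for x y
    using inj_on_radix that by (auto dest: inj_onD)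
  have "card (host_arcs m K) < t_trans n witness"
  proof (rule card_less_t_trans)
    show "host_arcs m K \<subseteq> (parcs (trans_tournament n))\<inverse>"
    proof (rule subrelI)
      fix c r assume "(c, r) \<in> host_arcs m K"
      then show "(c, r) \<in> (parcs (trans_tournament n))\<inverse>"
        using host_arcs_split[of c r m K] assms by (simp add: trans_tournament_def)
    qed
  next
    fix f :: "nat \<Rightarrow> nat"
    assume f: "inj_on f (pverts witness)"
      "\<And>u v. (u, v) \<in> parcs witness \<Longrightarrow> f u < f v \<or> (f u, f v) \<in> host_arcs m K"
    show False
    proof (rule witness_not_embeddable[OF _ _ _ f])
      show "r < K * base m ^ m \<and> K * base m ^ m \<le> c" if "(c, r) \<in> host_arcs m K" for c r
        using host_arcs_split[OF that] by simp
      show "c = c'" if "(c, r) \<in> host_arcs m K" "(c, r') \<in> host_arcs m K"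
        "(c', r) \<in> host_arcs m K" "(c', r') \<in> host_arcs m K" "r \<noteq> r'" for c c' r r'
        using that word_edges_four_cycle_free by (elim host_arcsE) (auto simp: inj)
      show "x' \<le> x" if "(a1, x) \<in> host_arcs m K" "(a2, x) \<in> host_arcs m K" "(y, x) \<in> host_arcs m K"
        "(b0, x') \<in> host_arcs m K" "(b1, x') \<in> host_arcs m K" "(y, x') \<in> host_arcs m K"
        "b0 < a1" "a1 < b1" "b1 < a2" "a2 < y" for x x' b0 a1 b1 a2 y
        using that by (elim host_arcsE) (auto simp: inj intro: word_edges_alternation_free)
    qed auto
  qed
  then show ?thesis
    by (simp add: card_host_arcs)
qed

theorem theorem6:
  shows "\<exists>H :: nat pair_pre_digraph. tournament_forest H \<and>
    filterlim (\<lambda>n. real (t_trans n H) / (real n * ln (real n))) at_top sequentially"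
proof (intro exI conjI)
  show "tournament_forest witness"
    by (rule witness_forest)
  show "filterlim (\<lambda>n. real (t_trans n witness) / (real n * ln (real n))) at_top sequentially"
    unfolding filterlim_at_top
  proof
    fix C :: real
    show "\<forall>\<^sub>F n in sequentially. C \<le> real (t_trans n witness) / (real n * ln (real n))"
      using dense_word_edges[of C] eventually_gt_at_top[of 1]
    proof eventually_elim
      case (elim n)
      then obtain m K where "2 * (K * base m ^ m) \<le> n"
        and "C * (real n * ln (real n)) \<le> real (card (word_edges m K))"
        by blast
      then have "C * (real n * ln (real n)) \<le> real (t_trans n witness)"
        using card_word_edges_less_t_trans[of K m n] by linarith
      then show ?case
        using elim by (simp add: le_divide_eq)
    qed
  qed
qed

end
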